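(* Let $n, t$ be positive integers such that for any two distinct prime powers $p^k, q^l$ with $k,l\ge1$, $p^k \,\|\, n$ and $q^l \,\|\, n$, one has $\gcd\!\left(\frac{p^{t(k+1)}-1}{p^t-1}, \frac{q^{t(l+1)}-1}{q^t-1}\right) = 1$. Let $$S := \left\langle \left\{ \sigma_t(m) : m \text{ is a positive integer and } \tfrac{m}{n} \text{ is a prime power} \right\}\right\rangle,$$ where $1$ counts as a prime power. Then $S$ is a numerical semigroup with Frobenius number $$F(S) = \sigma_t(n)\left(-1 + \sum_{1 < p^k \,\|\, n} \frac{p^{2t(k+1)} - p^t}{p^{t(k+1)} - 1}\right),$$ where the sum ranges over prime powers $p^k>1$ with $p^k\,\|\,n$.
   Context: $\sigma_t(m) := \sum_{d \mid m} d^t$. For a prime power $p^k$, $p^k \,\|\, n$ means $p^k \mid n$ but $p^{k+1}\nmid n$. For a set $A$ of positive integers, $\langle A\rangle$ is the submonoid of $(\mathbb{N},+)$ generated by $A$ ($\mathbb{N}$ = nonnegative integers). A numerical semigroup is a submonoid $S\subseteq\mathbb{N}$ with $\mathbb{N}\setminus S$ finite; its Frobenius number $F(S)$ is the largest integer not in $S$ (with $F(\mathbb{N})=-1$). *)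

theory Defs
  imports Complex_Main "HOL-Number_Theory.Prime_Powers"
begin

definition divisor_sigma :: "nat \<Rightarrow> nat \<Rightarrow> nat" where
  "divisor_sigma t m = (\<Sum>d | d dvd m. d ^ t)"

definition add_submonoid :: "nat set \<Rightarrow> bool" where
  "add_submonoid S \<longleftrightarrow> 0 \<in> S \<and> (\<forall>x\<in>S. \<forall>y\<in>S. x + y \<in> S)"

definition numerical_semigroup :: "nat set \<Rightarrow> bool" where
  "numerical_semigroup S \<longleftrightarrow> add_submonoid S \<and> finite (UNIV - S)"

(* The maximum is taken over all integers, negative ones included, so that the value is -1 for
   S = UNIV without a case distinction. *)
definition frobenius_number :: "nat set \<Rightarrow> int" where
  "frobenius_number S = (GREATEST x::int. x \<notin> int ` S)"

(* The prime powers p ^ k > 1 with p ^ k || n, each represented by its unique pair (p, k). *)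
definition exact_prime_powers :: "nat \<Rightarrow> (nat \<times> nat) set" where
  "exact_prime_powers n = {(p, k). prime p \<and> 1 \<le> k \<and> p ^ k dvd n \<and> \<not> p ^ (k + 1) dvd n}"

lemma finite_exact_prime_powers:
  assumes "n > 0"
  shows "finite (exact_prime_powers n)"
proof (rule finite_subset)
  show "exact_prime_powers n \<subseteq> {..n} \<times> {..n}"
  proof
    fix x assume "x \<in> exact_prime_powers n"
    then obtain p k where x: "x = (p, k)" and p: "prime p" and k: "1 \<le> k" and d: "p ^ k dvd n"
      by (auto simp: exact_prime_powers_def)
    have le: "p ^ k \<le> n" using d assms by (rule dvd_imp_le)
    have "p ^ 1 \<le> p ^ k" using k prime_ge_1_nat[OF p] by (rule power_increasing)
    moreover have "k < p ^ k" using prime_gt_1_nat[OF p] by (simp add: power_gt_expt)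
    ultimately show "x \<in> {..n} \<times> {..n}" using le x by simp
  qed
qed simp

end

theory Submission
  imports Defs "HOL-Number_Theory.Cong"
begin

text \<open>
  Write \<open>A = \<sigma>\<^sub>t(n)\<close> as the product of the pairwise coprime numbers
  \<open>a\<^sub>i = \<sigma>\<^sub>t(p\<^sub>i ^ k\<^sub>i)\<close> over the prime powers exactly dividing \<open>n\<close>. Then \<open>S\<close> is the sum of the
  semigroups \<open>(A / a\<^sub>i) T\<^sub>i\<close>, where \<open>T\<^sub>i\<close> is generated by the numbers
  \<open>\<sigma>\<^sub>t(p\<^sub>i ^ (k\<^sub>i + j))\<close>, \<open>j \<ge> 0\<close>, which are the repunits in base \<open>p\<^sub>i ^ t\<close> with more than
  \<open>k\<^sub>i\<close> digits. The Frobenius number of a semigroup containing \<open>a\<close> is the largest element of its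
  Apery set modulo \<open>a\<close>, minus \<open>a\<close>. By the Chinese remainder theorem the largest Apery elements
  \<open>W\<^sub>i\<close> of the \<open>T\<^sub>i\<close> modulo \<open>a\<^sub>i\<close> combine to the largest Apery element
  \<open>\<Sum> (A / a\<^sub>i) W\<^sub>i\<close> of \<open>S\<close> modulo \<open>A\<close>, and writing residues greedily as sums of repunits
  gives \<open>W\<^sub>i = a\<^sub>i (p\<^sub>i ^ (t (k\<^sub>i + 1)) + 1) - 1\<close>.
\<close>

section \<open>Submonoids of the natural numbers\<close>

lemma add_submonoid_hull: "add_submonoid (add_submonoid hull G)"
  by (rule hull_in) (auto simp: add_submonoid_def)

lemma add_submonoid_mult:
  assumes "add_submonoid S" "x \<in> S"
  shows "c * x \<in> S"
  using assms by (induction c) (auto simp: add_submonoid_def)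

lemma add_submonoid_sum:
  assumes "add_submonoid S" "\<And>i. i \<in> I \<Longrightarrow> f i \<in> S"
  shows "sum f I \<in> S"
  using assms(2)
  by (induction I rule: infinite_finite_induct) (use assms(1) in \<open>auto simp: add_submonoid_def\<close>)

lemma add_submonoid_hull_scale:
  assumes "add_submonoid S" "x \<in> add_submonoid hull G" "\<And>g. g \<in> G \<Longrightarrow> c * g \<in> S"
  shows "c * x \<in> S"
  using assms(2)
proof (rule hull_induct)
  show "add_submonoid {x. c * x \<in> S}"
    using assms(1) by (auto simp: add_submonoid_def distrib_left)
qed (rule assms(3))

section \<open>Apery sets and the Frobenius number\<close>

text \<open>\<open>W\<close> is the largest of the least elements of \<open>S\<close> in the residue classes modulo \<open>a\<close>.\<close>

definition max_apery :: "nat set \<Rightarrow> nat \<Rightarrow> nat \<Rightarrow> bool" where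
  "max_apery S a W \<longleftrightarrow>
    (\<forall>x. \<exists>w\<in>S. [w = x] (mod a) \<and> w \<le> W) \<and> (\<forall>w\<in>S. [w = W] (mod a) \<longrightarrow> W \<le> w)"

text \<open>Every natural number above \<open>W - a\<close> exceeds some element of \<open>S\<close>
  in its class by a multiple of \<open>a\<close>, whereas \<open>W - a\<close> in \<open>S\<close>
  would contradict the minimality of \<open>W\<close> in its class.\<close>

lemma max_apery_frobenius_number:
  assumes S: "add_submonoid S" "a \<in> S" and a: "a > 0" and W: "max_apery S a W"
  shows "numerical_semigroup S \<and> frobenius_number S = int W - int a"
proof -
  have in_S: "x \<in> S" if x: "W < x + a" for x
  proof -
    obtain w where w: "w \<in> S" "[w = x] (mod a)" "w \<le> W"
      using W unfolding max_apery_def by blast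
    \<comment> \<open>Otherwise \<open>w - x\<close> is a positive multiple of \<open>a\<close>, so
      \<open>x + a \<le> w \<le> W\<close>, against the choice of \<open>x\<close>.\<close>
    have "w \<le> x"
    proof (rule ccontr)
      assume "\<not> w \<le> x"
      moreover then have "a dvd w - x"
        using w(2) by (simp add: cong_altdef_nat)
      ultimately have "a \<le> w - x"
        by (intro dvd_imp_le) auto
      then show False
        using w(3) x \<open>\<not> w \<le> x\<close> by linarith
    qed
    then obtain c where "x = c * a + w"
      using w(2) by (metis cong_le_nat cong_sym)
    then show ?thesis
      using S(1) add_submonoid_mult[OF S, of c] w(1) by (auto simp: add_submonoid_def)
  qed
  have "UNIV - S \<subseteq> {..W}"
    using in_S a by (auto simp flip: not_less intro: trans_less_add1)
  then have "numerical_semigroup S"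
    using S(1) by (auto simp: numerical_semigroup_def intro: finite_subset)
  moreover have "frobenius_number S = int W - int a"
    unfolding frobenius_number_def
  proof (rule Greatest_equality)
    show "int W - int a \<notin> int ` S"
    proof
      assume "int W - int a \<in> int ` S"
      then obtain s where s: "s \<in> S" "int W - int a = int s"
        by auto
      then have "W = s + a"
        by linarith
      moreover from this have "W \<le> s"
        using W s(1) unfolding max_apery_def by (metis cong_def mod_add_self2)
      ultimately show False
        using a by simp
    qed
  next
    fix y assume y: "y \<notin> int ` S"
    show "y \<le> int W - int a"
    proof (rule ccontr)
      assume less: "\<not> y \<le> int W - int a"
      \<comment> \<open>If \<open>W + 1 < a\<close>, no element up to \<open>W\<close> could
        represent the residue \<open>W + 1\<close>. Hence \<open>W - a\<close> is at least -1, and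
        an integer above it cannot be negative.\<close>
      have "a \<le> W + 1"
      proof (rule ccontr)
        obtain w where "w \<in> S" "[w = W + 1] (mod a)" "w \<le> W"
          using W unfolding max_apery_def by blast
        moreover assume "\<not> a \<le> W + 1"
        ultimately show False
          by (simp add: cong_def)
      qed
      with less have "y \<ge> 0"
        by linarith
      with less have "nat y \<in> S"
        by (intro in_S) linarith
      with y \<open>y \<ge> 0\<close> show False
        by (metis imageI nat_0_le)
    qed
  qed
  ultimately show ?thesis ..
qed

section \<open>Gluing semigroups by the Chinese remainder theorem\<close>

lemma cong_sum_cofactors:
  fixes a f :: "'i \<Rightarrow> nat"
  assumes "finite I" "i \<in> I"
  shows "[(\<Sum>j\<in>I. (\<Prod>l\<in>I - {j}. a l) * f j) = (\<Prod>l\<in>I - {i}. a l) * f i] (mod a i)"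
proof -
  have "a i dvd (\<Prod>l\<in>I - {j}. a l) * f j" if "j \<in> I - {i}" for j
    using that assms by (intro dvd_mult2 dvd_prodI) auto
  then have "a i dvd (\<Sum>j\<in>I - {i}. (\<Prod>l\<in>I - {j}. a l) * f j)"
    by (rule dvd_sum)
  then show ?thesis
    using assms by (simp add: sum.remove cong_def mod_add_eq[symmetric])
qed

text \<open>Modulo \<open>a i\<close> only the summand of \<open>i\<close> survives, and its
  cofactor is invertible. A residue modulo the product therefore amounts to independent residues for
  the \<open>f i\<close>, and the weighted sum is extremal when each \<open>f i\<close> is. The term
  \<open>prod a I * c\<close> changes no residue and never makes an element smaller.\<close>

lemma max_apery_glue:
  fixes a W :: "'i \<Rightarrow> nat"
  assumes fin: "finite I"
    and cop: "\<And>i j. i \<in> I \<Longrightarrow> j \<in> I \<Longrightarrow> i \<noteq> j \<Longrightarrow> coprime (a i) (a j)"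
    and W: "\<And>i. i \<in> I \<Longrightarrow> max_apery (T i) (a i) (W i)"
    and sum_in: "\<And>f. (\<forall>i\<in>I. f i \<in> T i) \<Longrightarrow> (\<Sum>i\<in>I. (\<Prod>l\<in>I - {i}. a l) * f i) \<in> S"
    and S_sum: "\<And>x. x \<in> S \<Longrightarrow> \<exists>f c. (\<forall>i\<in>I. f i \<in> T i) \<and>
      x = prod a I * c + (\<Sum>i\<in>I. (\<Prod>l\<in>I - {i}. a l) * f i)"
  shows "max_apery S (prod a I) (\<Sum>i\<in>I. (\<Prod>l\<in>I - {i}. a l) * W i)"
  unfolding max_apery_def
proof (intro conjI allI ballI impI)
  have cop_cofactor: "coprime (\<Prod>l\<in>I - {i}. a l) (a i)" if "i \<in> I" for i
    using that cop by (intro prod_coprime_left) auto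
  {
    fix x
    have "\<exists>w\<in>T i. [(\<Prod>l\<in>I - {i}. a l) * w = x] (mod a i) \<and> w \<le> W i" if i: "i \<in> I" for i
    proof -
      obtain y where y: "[(\<Prod>l\<in>I - {i}. a l) * y = Suc 0] (mod a i)"
        using cong_solve_coprime_nat[OF cop_cofactor[OF i]] ..
      obtain w where w: "w \<in> T i" "[w = y * x] (mod a i)" "w \<le> W i"
        using W[OF i] unfolding max_apery_def by blast
      have "[(\<Prod>l\<in>I - {i}. a l) * w = (\<Prod>l\<in>I - {i}. a l) * (y * x)] (mod a i)"
        using w(2) by (rule cong_scalar_left)
      also have "[(\<Prod>l\<in>I - {i}. a l) * (y * x) = x] (mod a i)"
        using cong_scalar_right[OF y, of x] by (simp add: mult.assoc)
      finally show ?thesis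
        using w by blast
    qed
    then obtain f where f: "\<And>i. i \<in> I \<Longrightarrow>
      f i \<in> T i \<and> [(\<Prod>l\<in>I - {i}. a l) * f i = x] (mod a i) \<and> f i \<le> W i"
      by metis
    let ?w = "\<Sum>i\<in>I. (\<Prod>l\<in>I - {i}. a l) * f i"
    have "[?w = x] (mod prod a I)"
      using cop f cong_sum_cofactors[OF fin] by (intro coprime_cong_prod_nat) (blast intro: cong_trans)+
    moreover have "?w \<in> S"
      using f by (intro sum_in) blast
    moreover have "?w \<le> (\<Sum>i\<in>I. (\<Prod>l\<in>I - {i}. a l) * W i)"
      using f by (intro sum_mono mult_left_mono) auto
    ultimately show "\<exists>w\<in>S. [w = x] (mod prod a I) \<and> w \<le> (\<Sum>i\<in>I. (\<Prod>l\<in>I - {i}. a l) * W i)"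
      by blast
  }
  fix w
  assume "w \<in> S" and cong: "[w = (\<Sum>i\<in>I. (\<Prod>l\<in>I - {i}. a l) * W i)] (mod prod a I)"
  then obtain f c where f: "\<And>i. i \<in> I \<Longrightarrow> f i \<in> T i"
    and w: "w = prod a I * c + (\<Sum>i\<in>I. (\<Prod>l\<in>I - {i}. a l) * f i)"
    using S_sum by blast
  have "W i \<le> f i" if i: "i \<in> I" for i
  proof -
    have dvd: "a i dvd prod a I"
      using fin i by (rule dvd_prodI)
    have "[(\<Prod>l\<in>I - {i}. a l) * f i = (\<Sum>j\<in>I. (\<Prod>l\<in>I - {j}. a l) * f j)] (mod a i)"
      using cong_sum_cofactors[OF fin i] by (rule cong_sym)
    also have "[(\<Sum>j\<in>I. (\<Prod>l\<in>I - {j}. a l) * f j) = w] (mod a i)"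
      using dvd by (simp add: w cong_def mod_add_eq[symmetric])
    also have "[w = (\<Sum>j\<in>I. (\<Prod>l\<in>I - {j}. a l) * W j)] (mod a i)"
      using cong dvd by (rule cong_dvd_modulus_nat)
    also have "[(\<Sum>j\<in>I. (\<Prod>l\<in>I - {j}. a l) * W j) = (\<Prod>l\<in>I - {i}. a l) * W i] (mod a i)"
      using fin i by (rule cong_sum_cofactors)
    finally have "[f i = W i] (mod a i)"
      using cop_cofactor[OF i] by (simp add: cong_mult_lcancel_nat)
    then show ?thesis
      using W[OF i] f[OF i] by (simp add: max_apery_def)
  qed
  then have "(\<Sum>i\<in>I. (\<Prod>l\<in>I - {i}. a l) * W i) \<le> (\<Sum>i\<in>I. (\<Prod>l\<in>I - {i}. a l) * f i)"
    by (intro sum_mono mult_left_mono) auto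
  then show "(\<Sum>i\<in>I. (\<Prod>l\<in>I - {i}. a l) * W i) \<le> w"
    by (simp add: w)
qed

section \<open>Semigroups generated by repunits\<close>

definition repunit :: "nat \<Rightarrow> nat \<Rightarrow> nat" where
  "repunit q m = (\<Sum>i<m. q ^ i)"

lemma repunit_0 [simp]: "repunit q 0 = 0"
  and repunit_Suc: "repunit q (Suc m) = repunit q m + q ^ m"
  by (simp_all add: repunit_def)

text \<open>The geometric sum formula, freed of subtraction and division by writing the base as
  \<open>Suc b\<close>.\<close>

lemma power_eq_repunit: "Suc b ^ m = b * repunit (Suc b) m + 1"
  by (induction m) (simp_all add: repunit_Suc algebra_simps)

lemma repunit_Suc': "repunit (Suc b) (Suc m) = Suc b * repunit (Suc b) m + 1"
  by (simp add: repunit_Suc power_eq_repunit)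

lemma repunit_add:
  "repunit (Suc b) (m + j) = repunit (Suc b) j + repunit (Suc b) m * Suc b ^ j"
proof (induction j)
  case (Suc j)
  then show ?case
    by (simp add: repunit_Suc power_add power_eq_repunit[of b m] algebra_simps)
qed simp

text \<open>
  With \<open>a = repunit q N\<close>, \<open>repunit_add\<close> says that choosing generators \<open>repunit q (N + j)\<close> amounts
  to choosing repunits \<open>repunit q j\<close> with sum \<open>\<rho>\<close>, at the cost of \<open>V\<close> multiples of \<open>a\<close>, where
  \<open>V\<close> is the sum of the corresponding powers \<open>q ^ j\<close>.
\<close>

lemma repunit_greedy:
  assumes T: "add_submonoid T" "\<And>j. repunit (Suc b) j + a * Suc b ^ j \<in> T"
    and "\<rho> < repunit (Suc b) m"
  shows "\<exists>V \<le> Suc b ^ m. \<rho> + a * V \<in> T"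
  using assms(3)
proof (induction m arbitrary: \<rho>)
  case (Suc m)
  let ?r = "repunit (Suc b) m"
  have mult: "d * ?r + a * (d * Suc b ^ m) \<in> T" for d
    using add_submonoid_mult[OF T(1) T(2)[of m], of d] by (simp add: algebra_simps)
  have le: "\<rho> \<le> Suc b * ?r"
    using Suc.prems by (simp add: repunit_Suc')
  show ?case
  \<comment> \<open>Below the top value \<open>Suc b * ?r\<close> the greedy quotient is at most
    \<open>b\<close>, which leaves \<open>Suc b ^ m\<close> for the remainder. The top value itself
    is \<open>Suc b\<close> copies of \<open>?r\<close> and uses up the whole bound.\<close>
  proof (cases "\<rho> = Suc b * ?r")
    case True
    then show ?thesis
      using mult[of "Suc b"] by (intro exI[of _ "Suc b ^ Suc m"]) simp
  next
    case False
    with le have less: "\<rho> < Suc b * ?r"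
      by simp
    then have "?r > 0"
      by (cases ?r) auto
    then have "\<rho> mod ?r < ?r"
      by simp
    then obtain V where V: "V \<le> Suc b ^ m" "\<rho> mod ?r + a * V \<in> T"
      using Suc.IH by blast
    have "\<rho> div ?r < Suc b"
      using less by (rule less_mult_imp_div_less)
    then have "Suc (\<rho> div ?r) * Suc b ^ m \<le> Suc b * Suc b ^ m"
      by (intro mult_right_mono) auto
    then have "\<rho> div ?r * Suc b ^ m + V \<le> Suc b ^ Suc m"
      using V(1) unfolding power_Suc mult_Suc[of "\<rho> div ?r"] by linarith
    moreover have "(\<rho> div ?r * ?r + a * (\<rho> div ?r * Suc b ^ m)) + (\<rho> mod ?r + a * V) \<in> T"
      using mult V(2) T(1) by (simp add: add_submonoid_def)
    then have "(\<rho> div ?r * ?r + \<rho> mod ?r) + a * (\<rho> div ?r * Suc b ^ m + V) \<in> T"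
      by (simp only: distrib_left ac_simps)
    then have "\<rho> + a * (\<rho> div ?r * Suc b ^ m + V) \<in> T"
      by (simp only: div_mult_mod_eq)
    ultimately show ?thesis
      by blast
  qed
qed simp

text \<open>
  \<open>R\<close> is the sum and \<open>C\<close> the number of the repunits \<open>repunit q j\<close> chosen; those with
  \<open>j > L\<close> are at least \<open>a\<close>, the others are at most \<open>repunit q L\<close>.
\<close>

lemma repunit_hull_cases:
  assumes "x \<in> add_submonoid hull (range (\<lambda>j. repunit (Suc b) (Suc L + j)))" "L > 0"
  defines "a \<equiv> repunit (Suc b) (Suc L)"
  shows "\<exists>R C. x = R + a * (b * R + C) \<and> (R \<le> C * repunit (Suc b) L \<or> a \<le> R)"
  using assms(1)
proof (rule hull_induct)
  have mono: "repunit (Suc b) i \<le> repunit (Suc b) j" if "i \<le> j" for i j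
    using that by (auto simp: repunit_def intro: sum_mono2)
  fix x assume "x \<in> range (\<lambda>j. repunit (Suc b) (Suc L + j))"
  then obtain j where x: "x = repunit (Suc b) (Suc L + j)"
    by blast
  \<comment> \<open>A single generator has \<open>C = 1\<close>, as \<open>Suc b ^ j\<close> is
    \<open>b * repunit (Suc b) j + 1\<close>. Summing over the chosen repunits turns the cost
    \<open>V\<close> into \<open>b * R + C\<close>.\<close>
  have "x = repunit (Suc b) j + a * (b * repunit (Suc b) j + 1)"
    by (simp only: x repunit_add a_def power_eq_repunit)
  moreover have "repunit (Suc b) j \<le> 1 * repunit (Suc b) L \<or> a \<le> repunit (Suc b) j"
    using mono[of j L] mono[of "Suc L" j] unfolding a_def by linarith
  ultimately show "\<exists>R C. x = R + a * (b * R + C) \<and> (R \<le> C * repunit (Suc b) L \<or> a \<le> R)"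
    by blast
next
  show "add_submonoid {x. \<exists>R C. x = R + a * (b * R + C) \<and> (R \<le> C * repunit (Suc b) L \<or> a \<le> R)}"
    unfolding add_submonoid_def mem_Collect_eq
  proof (intro conjI ballI)
    fix x y
    assume "x \<in> {x. \<exists>R C. x = R + a * (b * R + C) \<and> (R \<le> C * repunit (Suc b) L \<or> a \<le> R)}"
      and "y \<in> {x. \<exists>R C. x = R + a * (b * R + C) \<and> (R \<le> C * repunit (Suc b) L \<or> a \<le> R)}"
    then obtain R C R' C' where "x = R + a * (b * R + C)" "y = R' + a * (b * R' + C')"
      "R \<le> C * repunit (Suc b) L \<or> a \<le> R" "R' \<le> C' * repunit (Suc b) L \<or> a \<le> R'"
      by blast
    then show "\<exists>R C. x + y = R + a * (b * R + C) \<and> (R \<le> C * repunit (Suc b) L \<or> a \<le> R)"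
      by (intro exI[of _ "R + R'"] exI[of _ "C + C'"]) (auto simp: algebra_simps)
  qed simp
qed

text \<open>The worst class is that of \<open>a - 1 = Suc b * repunit (Suc b) L\<close>, where
  \<open>a\<close> is the modulus: the greedy choice costs at most \<open>Suc b ^ Suc L\<close>
  multiples of \<open>a\<close> in every class, and in this one no choice costs less.\<close>

lemma max_apery_repunit:
  assumes b: "b > 0" and L: "L > 0"
  shows "max_apery (add_submonoid hull (range (\<lambda>j. repunit (Suc b) (Suc L + j))))
    (repunit (Suc b) (Suc L)) (repunit (Suc b) (Suc L) * (Suc b ^ Suc L + 1) - 1)"
proof -
  define T where "T = add_submonoid hull (range (\<lambda>j. repunit (Suc b) (Suc L + j)))"
  define a where "a = repunit (Suc b) (Suc L)"
  define r where "r = repunit (Suc b) L"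
  have a: "a = Suc b * r + 1"
    by (simp only: a_def r_def repunit_Suc')
  have q: "Suc b ^ Suc L = b * a + 1"
    by (simp only: a_def power_eq_repunit)
  have r: "r > 0"
    using L by (cases L) (auto simp: r_def repunit_Suc)
  have W: "a * (Suc b ^ Suc L + 1) - 1 = (a - 1) + a * Suc b ^ Suc L"
    using a by simp
  have "max_apery T a ((a - 1) + a * Suc b ^ Suc L)"
    unfolding max_apery_def
  proof (intro conjI allI ballI impI)
    fix x
    have "repunit (Suc b) j + a * Suc b ^ j \<in> T" for j
      unfolding T_def a_def repunit_add[symmetric] by (intro hull_inc) blast
    moreover have "x mod a < repunit (Suc b) (Suc L)"
      using a by (simp flip: a_def)
    ultimately obtain V where V: "V \<le> Suc b ^ Suc L" "x mod a + a * V \<in> T"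
      using repunit_greedy[of T] add_submonoid_hull unfolding T_def by blast
    have "x mod a < a"
      using a by simp
    then have "x mod a + a * V \<le> (a - 1) + a * Suc b ^ Suc L"
      using V(1) by (intro add_mono mult_left_mono) linarith+
    moreover have "[x mod a + a * V = x] (mod a)"
      by (simp add: cong_def)
    ultimately show "\<exists>w\<in>T. [w = x] (mod a) \<and> w \<le> (a - 1) + a * Suc b ^ Suc L"
      using V(2) by blast
  next
    fix w assume "w \<in> T" and cong: "[w = (a - 1) + a * Suc b ^ Suc L] (mod a)"
    then obtain R C where w: "w = R + a * (b * R + C)" and RC: "R \<le> C * r \<or> a \<le> R"
      using repunit_hull_cases[OF _ L, of w b] unfolding T_def a_def r_def by blast
    have "R mod a = w mod a"
      by (simp add: w)
    also have "\<dots> = (a - 1) mod a"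
      using cong by (simp add: cong_def)
    also have "\<dots> = a - 1"
      by (rule mod_less) (simp add: a)
    finally have "R mod a = a - 1" .
    then have R: "R = a * (R div a) + (a - 1)"
      by (metis mult_div_mod_eq)
    \<comment> \<open>The left side is \<open>Suc b ^ Suc L\<close>. If \<open>R = a - 1\<close>,
      the chosen repunits are at most \<open>r\<close> on average, so at least \<open>Suc b\<close>
      of them are needed; otherwise \<open>R \<ge> 2 * a - 1\<close>, and \<open>b * R\<close> alone
      is large enough.\<close>
    have "b * a + 1 \<le> b * R + C"
    proof (cases "R div a = 0")
      case True
      with R have R: "R = Suc b * r"
        using a by simp
      with RC a have "Suc b * r \<le> C * r"
        by linarith
      with r have "Suc b \<le> C"
        by (metis mult_le_cancel2)
      then show ?thesis
        by (simp add: R a algebra_simps)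
    next
      case False
      then have "a * 1 \<le> a * (R div a)"
        by (intro mult_left_mono) auto
      then have "a + (a - 1) \<le> R"
        using R by linarith
      then have "b * (a + (a - 1)) \<le> b * R"
        by (rule mult_left_mono) simp
      moreover have "b * (a - 1) \<ge> 1"
        using a b r by simp
      ultimately show ?thesis
        by (simp only: distrib_left)
    qed
    then have "a * Suc b ^ Suc L \<le> a * (b * R + C)"
      unfolding q by (rule mult_left_mono) simp
    moreover have "a - 1 \<le> R"
      using R by linarith
    ultimately show "(a - 1) + a * Suc b ^ Suc L \<le> w"
      unfolding w by (rule add_mono[rotated])
  qed
  then show ?thesis
    unfolding T_def[symmetric] a_def[symmetric] W .
qed

section \<open>Divisor sums and exact prime powers\<close>

text \<open>Multiplication of a divisor of \<open>m\<close> by a divisor of \<open>n\<close> has the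
  inverse that sends \<open>d\<close> to \<open>(gcd d m, gcd d n)\<close>.\<close>

lemma divisor_sigma_coprime_mult:
  assumes "coprime m n"
  shows "divisor_sigma t (m * n) = divisor_sigma t m * divisor_sigma t n"
proof -
  have gcd_mult: "gcd (x * y) m = x \<and> gcd (x * y) n = y" if "x dvd m" "y dvd n" for x y
  proof -
    have "coprime y m" "coprime x n"
      using that assms by (meson coprime_commute coprime_divisors dvd_refl)+
    then show ?thesis
      using that by (simp add: gcd_mult_left_left_cancel gcd_mult_left_right_cancel coprime_commute
          gcd_nat.absorb1)
  qed
  have "divisor_sigma t m * divisor_sigma t n =
      (\<Sum>(x, y)\<in>{d. d dvd m} \<times> {d. d dvd n}. (x * y) ^ t)"
    by (simp add: divisor_sigma_def sum_product sum.cartesian_product power_mult_distrib)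
  also have "\<dots> = (\<Sum>d | d dvd m * n. d ^ t)"
  proof (rule sum.reindex_bij_witness[where j = "\<lambda>(x, y). x * y" and i = "\<lambda>d. (gcd d m, gcd d n)"])
    fix d assume "d \<in> {d. d dvd m * n}"
    then obtain x y where "d = x * y" "x dvd m" "y dvd n"
      using division_decomp by blast
    then show "(case (gcd d m, gcd d n) of (x, y) \<Rightarrow> x * y) = d"
      by (simp add: gcd_mult)
  qed (auto simp: gcd_mult intro: mult_dvd_mono)
  finally show ?thesis
    by (simp add: divisor_sigma_def)
qed

lemma divisor_sigma_prod:
  assumes "\<And>i j. i \<in> I \<Longrightarrow> j \<in> I \<Longrightarrow> i \<noteq> j \<Longrightarrow> coprime (g i) (g j)"
  shows "divisor_sigma t (prod g I) = (\<Prod>i\<in>I. divisor_sigma t (g i))"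
  using assms
proof (induction I rule: infinite_finite_induct)
  case (insert i I)
  then have "coprime (g i) (prod g I)"
    by (intro prod_coprime_right) auto
  with insert show ?case
    by (simp add: divisor_sigma_coprime_mult)
qed (simp_all add: divisor_sigma_def)

lemma divisor_sigma_prime_power:
  assumes "prime p"
  shows "divisor_sigma t (p ^ k) = repunit (p ^ t) (Suc k)"
proof -
  have "{d. d dvd p ^ k} = (\<lambda>i. p ^ i) ` {..<Suc k}"
    using assms by (auto simp: divides_primepow_nat image_iff less_Suc_eq_le)
  moreover have "inj_on (\<lambda>i. p ^ i) {..<Suc k}"
    using prime_gt_1_nat[OF assms] by (auto simp: inj_on_def)
  ultimately show ?thesis
    by (simp add: divisor_sigma_def repunit_def sum.reindex mult.commute flip: power_mult)
qed

text \<open>The prime determines the exponent, so products over the pairs become products over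
  \<open>prime_factors n\<close>.\<close>

lemma exact_prime_powers_eq:
  assumes "n > 0"
  shows "exact_prime_powers n = (\<lambda>p. (p, multiplicity p n)) ` prime_factors n"
proof -
  have "(p, k) \<in> exact_prime_powers n \<longleftrightarrow> p \<in> prime_factors n \<and> k = multiplicity p n" for p k
  proof (cases "prime p")
    case True
    have "p ^ k dvd n \<and> \<not> p ^ (k + 1) dvd n \<longleftrightarrow> k = multiplicity p n"
      using assms prime_gt_1_nat[OF True]
      by (auto simp: power_dvd_iff_le_multiplicity simp del: power_Suc power_Suc2 power_Suc0_right)
    then show ?thesis
      using True assms
      by (auto simp: exact_prime_powers_def prime_factors_multiplicity Suc_le_eq)
  qed (auto simp: exact_prime_powers_def)
  then show ?thesis
    by (auto simp: set_eq_iff)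
qed

lemma prod_exact_prime_powers:
  assumes "n > 0"
  shows "(\<Prod>(p, k)\<in>exact_prime_powers n. p ^ k) = n"
  using assms by (simp add: exact_prime_powers_eq prod.reindex inj_on_def flip: prime_factorization_nat)

lemma coprime_exact_prime_powers:
  assumes "n > 0" "i \<in> exact_prime_powers n" "j \<in> exact_prime_powers n" "i \<noteq> j"
  shows "coprime (fst i ^ snd i) (fst j ^ snd j)"
  using assms by (auto simp: exact_prime_powers_eq intro!: primes_coprime)

section \<open>The semigroup of divisor sums as a gluing of repunit semigroups\<close>

theorem theorem1p4:
  fixes n t :: nat and S :: "nat set"
  assumes "n > 0" and "t > 0"
    and "\<And>p k q l. (p, k) \<in> exact_prime_powers n \<Longrightarrow> (q, l) \<in> exact_prime_powers n \<Longrightarrow> p ^ k \<noteq> q ^ l \<Longrightarrow>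
      gcd ((int p ^ (t * (k + 1)) - 1) div (int p ^ t - 1))
          ((int q ^ (t * (l + 1)) - 1) div (int q ^ t - 1)) = 1"
    and "S = add_submonoid hull
      {divisor_sigma t m | m. m > 0 \<and> (\<exists>r. (r = 1 \<or> primepow r) \<and> m = n * r)}"
  shows "numerical_semigroup S \<and>
    real_of_int (frobenius_number S) =
      real (divisor_sigma t n) *
        (- 1 + (\<Sum>(p, k)\<in>exact_prime_powers n.
          (real p ^ (2 * t * (k + 1)) - real p ^ t) / (real p ^ (t * (k + 1)) - 1)))"
proof -
  note n = assms(1) and t = assms(2) and gcd = assms(3) and S = assms(4)
  define I where "I = exact_prime_powers n"
  define s where "s i j = divisor_sigma t (fst i ^ (snd i + j))" for i :: "nat \<times> nat" and j
  define a where "a i = s i 0" for i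
  define b where "b i = fst i ^ t - 1" for i :: "nat \<times> nat"
  define T where "T i = add_submonoid hull range (s i)" for i
  define W where "W i = a i * (fst i ^ (t * (snd i + 1)) + 1) - 1" for i
  define M where "M i = (\<Prod>l\<in>I - {i}. a l)" for i
  define A where "A = divisor_sigma t n"
  have fin: "finite I"
    using n by (simp add: I_def finite_exact_prime_powers)
  have prime: "prime (fst i)" and pos: "snd i > 0" if "i \<in> I" for i
    using that by (auto simp: I_def exact_prime_powers_def)
  have b: "b i > 0" "fst i ^ t = Suc (b i)" if "i \<in> I" for i
    using one_less_power[OF prime_gt_1_nat[OF prime[OF that]] t] by (auto simp: b_def)
  have s_repunit: "s i j = repunit (Suc (b i)) (Suc (snd i) + j)" if "i \<in> I" for i j
    using that by (simp add: s_def divisor_sigma_prime_power prime b)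
  have a_repunit: "a i = repunit (Suc (b i)) (Suc (snd i))" if "i \<in> I" for i
    using that by (simp add: a_def s_repunit)
  have a_pos: "a i > 0" if "i \<in> I" for i
    using that by (simp add: a_repunit repunit_Suc')
  have power: "fst i ^ (t * (snd i + 1)) = b i * a i + 1" if "i \<in> I" for i
    using power_eq_repunit[of "b i" "Suc (snd i)"] that
    by (simp only: a_repunit power_mult b Suc_eq_plus1[symmetric])
  have A: "A = prod a I"
  proof -
    have "A = divisor_sigma t (\<Prod>i\<in>I. fst i ^ snd i)"
      using prod_exact_prime_powers[OF n] by (simp add: A_def I_def case_prod_beta)
    also have "\<dots> = prod a I"
      using coprime_exact_prime_powers[OF n] by (subst divisor_sigma_prod) (auto simp: I_def a_def s_def)
    finally show ?thesis .
  qed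
  have A_M: "A = M i * a i" if "i \<in> I" for i
    using that fin by (simp add: A M_def prod.remove mult.commute)
  \<comment> \<open>The cofactor \<open>M i\<close> is the divisor sum of the part \<open>m\<close>
    of \<open>n\<close> prime to \<open>fst i\<close>; multiplying \<open>n\<close> by
    \<open>fst i ^ j\<close> leaves this part alone.\<close>
  have sigma_M: "divisor_sigma t (n * fst i ^ j) = M i * s i j" if i: "i \<in> I" for i j
  proof -
    obtain m where m: "n = fst i ^ snd i * m"
      using i by (auto simp: I_def exact_prime_powers_def)
    have "\<not> fst i dvd m"
      using i m by (auto simp: I_def exact_prime_powers_def)
    then have "coprime (fst i ^ l) m" for l
      using prime[OF i] by (simp add: prime_imp_coprime)
    then have mult: "divisor_sigma t (fst i ^ l * m) = divisor_sigma t (fst i ^ l) * divisor_sigma t m" for l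
      by (rule divisor_sigma_coprime_mult)
    have "a i * M i = a i * divisor_sigma t m"
      using A_M[OF i] mult[of "snd i"] by (simp add: A_def a_def s_def m mult.commute)
    then have "divisor_sigma t m = M i"
      using a_pos[OF i] by simp
    moreover have "n * fst i ^ j = fst i ^ (snd i + j) * m"
      by (simp add: m power_add)
    ultimately show ?thesis
      by (simp add: mult s_def)
  qed
  have S_sub: "add_submonoid S"
    unfolding S by (rule add_submonoid_hull)
  have gen: "divisor_sigma t (n * r) \<in> S" if "r = 1 \<or> primepow r" for r
  proof -
    have "r > 0"
      using that primepow_gt_0_nat by auto
    with n that show ?thesis
      unfolding S by (intro hull_inc) auto
  qed
  have A_S: "A \<in> S"
    using gen[of 1] by (simp add: A_def)
  have "max_apery S (prod a I) (\<Sum>i\<in>I. (\<Prod>l\<in>I - {i}. a l) * W i)"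
  proof (rule max_apery_glue[OF fin])
    fix i j assume ij: "i \<in> I" "j \<in> I" "i \<noteq> j"
    \<comment> \<open>The quotients in the gcd hypothesis are the geometric sums
      \<open>a i\<close>.\<close>
    have "(int (fst i) ^ (t * (snd i + 1)) - 1) div (int (fst i) ^ t - 1) = int (a i)" if "i \<in> I" for i
    proof -
      have "int (fst i) ^ (t * (snd i + 1)) = int (b i) * int (a i) + 1"
        using arg_cong[OF power[OF that], of int] by simp
      moreover have "int (fst i) ^ t = int (b i) + 1"
        using arg_cong[OF b(2)[OF that], of int] by simp
      ultimately show ?thesis
        using b(1)[OF that] by simp
    qed
    \<comment> \<open>The gcd hypothesis compares prime powers by value, while \<open>I\<close>
      consists of pairs; equal coprime powers would be 1.\<close>
    moreover have "fst i ^ snd i \<noteq> fst j ^ snd j"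
    proof
      assume "fst i ^ snd i = fst j ^ snd j"
      with coprime_exact_prime_powers[OF n] ij have "fst i ^ snd i = 1"
        by (metis I_def coprime_self nat_dvd_1_iff_1)
      then show False
        using prime_gt_1_nat[OF prime[OF ij(1)]] pos[OF ij(1)] by simp
    qed
    ultimately show "coprime (a i) (a j)"
      using gcd[of "fst i" "snd i" "fst j" "snd j"] ij
      by (simp add: I_def coprime_iff_gcd_eq_1 flip: coprime_int_iff)
  next
    fix i assume i: "i \<in> I"
    have "s i = (\<lambda>j. repunit (Suc (b i)) (Suc (snd i) + j))"
      using s_repunit[OF i] by blast
    moreover have "W i = a i * (Suc (b i) ^ Suc (snd i) + 1) - 1"
      unfolding W_def power_mult b[OF i] by simp
    ultimately show "max_apery (T i) (a i) (W i)"
      using max_apery_repunit[OF b(1)[OF i] pos[OF i]] a_repunit[OF i] by (simp only: T_def)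
  next
    fix f assume f: "\<forall>i\<in>I. f i \<in> T i"
    show "(\<Sum>i\<in>I. (\<Prod>l\<in>I - {i}. a l) * f i) \<in> S"
      unfolding M_def[symmetric]
    proof (rule add_submonoid_sum[OF S_sub])
      fix i assume i: "i \<in> I"
      show "M i * f i \<in> S"
      proof (rule add_submonoid_hull_scale[OF S_sub])
        show "f i \<in> add_submonoid hull range (s i)"
          using f i by (simp add: T_def)
        fix g assume "g \<in> range (s i)"
        then obtain j where "g = s i j"
          by blast
        moreover have "fst i ^ j = 1 \<or> primepow (fst i ^ j)"
          using prime[OF i] by (cases "j = 0") auto
        ultimately show "M i * g \<in> S"
          using gen sigma_M[OF i] by metis
      qed
    qed
  next
    have T: "add_submonoid (T i)" for i
      unfolding T_def by (rule add_submonoid_hull)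
    \<comment> \<open>The sum over \<open>I\<close> collects the generators whose prime divides
      \<open>n\<close>. The multiple of \<open>A\<close> collects those with \<open>r = 1\<close> or
      \<open>r\<close> coprime to \<open>n\<close>, where the divisor sum of \<open>n * r\<close> is
      \<open>A\<close> times that of \<open>r\<close>.\<close>
    define P where "P x \<longleftrightarrow> (\<exists>f c. (\<forall>i\<in>I. f i \<in> T i) \<and> x = A * c + (\<Sum>i\<in>I. M i * f i))" for x
    have PI: "P (A * c + (\<Sum>i\<in>I. M i * f i))" if "\<forall>i\<in>I. f i \<in> T i" for c f
      using that unfolding P_def by blast
    have P_A: "P (A * c)" for c
      using PI[of "\<lambda>_. 0" c] T by (simp add: add_submonoid_def)
    have P_M: "P (M i * s i j)" if i: "i \<in> I" for i j
    proof -
      have "s i j \<in> T i"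
        unfolding T_def by (intro hull_inc) blast
      then have "P (A * 0 + (\<Sum>l\<in>I. M l * (if l = i then s i j else 0)))"
        using T by (intro PI) (auto simp: add_submonoid_def)
      moreover have "(\<Sum>l\<in>I. M l * (if l = i then s i j else 0)) = (\<Sum>l\<in>I. if l = i then M l * s i j else 0)"
        by (intro sum.cong) auto
      ultimately show ?thesis
        using fin i by simp
    qed
    fix x assume "x \<in> S"
    then have "P x"
      unfolding S
    proof (rule hull_induct)
      fix x
      assume "x \<in> {divisor_sigma t m | m. m > 0 \<and> (\<exists>r. (r = 1 \<or> primepow r) \<and> m = n * r)}"
      then obtain r where r: "r = 1 \<or> primepow r" "x = divisor_sigma t (n * r)"
        by blast
      from r(1) show "P x"
      proof
        assume "r = 1"
        then show ?thesis
          using P_A[of 1] by (simp add: r(2) A_def)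
      next
        assume "primepow r"
        then obtain p k where p: "prime p" and k: "k > 0" "r = p ^ k"
          unfolding primepow_def by blast
        show ?thesis
        proof (cases "p dvd n")
          case True
          then have "(p, multiplicity p n) \<in> I"
            using p n by (auto simp: I_def exact_prime_powers_eq prime_factors_dvd)
          then show ?thesis
            using P_M sigma_M[of "(p, multiplicity p n)" k] by (simp add: r(2) k(2))
        next
          case False
          then have "coprime n r"
            using prime_imp_coprime[OF p False] k(2) by (simp add: coprime_commute)
          then show ?thesis
            using P_A by (simp add: r(2) divisor_sigma_coprime_mult A_def)
        qed
      qed
    next
      show "add_submonoid {x. P x}"
        unfolding add_submonoid_def
      proof (intro conjI ballI; unfold mem_Collect_eq)
        show "P 0"
          using P_A[of 0] by simp
        fix x y assume "P x" "P y"
        then obtain f c g d where fg: "\<forall>i\<in>I. f i \<in> T i" "\<forall>i\<in>I. g i \<in> T i"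
          and "x = A * c + (\<Sum>i\<in>I. M i * f i)" "y = A * d + (\<Sum>i\<in>I. M i * g i)"
          unfolding P_def by blast
        then have "x + y = A * (c + d) + (\<Sum>i\<in>I. M i * (f i + g i))"
          by (simp add: distrib_left sum.distrib)
        moreover have "\<forall>i\<in>I. f i + g i \<in> T i"
          using fg T by (simp add: add_submonoid_def)
        ultimately show "P (x + y)"
          using PI[of "\<lambda>i. f i + g i" "c + d"] by simp
      qed
    qed
    then show "\<exists>f c. (\<forall>i\<in>I. f i \<in> T i) \<and>
        x = prod a I * c + (\<Sum>i\<in>I. (\<Prod>l\<in>I - {i}. a l) * f i)"
      unfolding P_def A M_def .
  qed
  then have "max_apery S A (\<Sum>i\<in>I. M i * W i)"
    by (simp add: A M_def)
  moreover have "A > 0"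
    using a_pos by (auto simp: A intro!: prod_pos)
  ultimately have F: "numerical_semigroup S \<and> frobenius_number S = int (\<Sum>i\<in>I. M i * W i) - int A"
    using max_apery_frobenius_number[OF S_sub A_S] by blast
  have term_eq: "real (M i * W i) = real A * ((real (fst i) ^ (2 * t * (snd i + 1)) - real (fst i) ^ t) /
      (real (fst i) ^ (t * (snd i + 1)) - 1))" if i: "i \<in> I" for i
  proof -
    have ab: "real (a i) > 0" "real (b i) > 0"
      using a_pos b i by simp_all
    have sq: "real (fst i) ^ (2 * t * (snd i + 1)) = (real (fst i) ^ (t * (snd i + 1)))\<^sup>2"
      by (simp only: power_mult[symmetric] ac_simps)
    have pow: "real (fst i) ^ (t * (snd i + 1)) = real (b i) * real (a i) + 1"
      using arg_cong[OF power[OF i], of real] by simp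
    have base: "real (fst i) ^ t = real (b i) + 1"
      using arg_cong[OF b(2)[OF i], of real] by simp
    \<comment> \<open>Adding 1 removes the truncated subtraction in \<open>W i\<close> before
      passing to the reals.\<close>
    have "W i + 1 = a i * (b i * a i + 2)"
      using a_pos[OF i] unfolding W_def power[OF i] by simp
    then have "real (W i + 1) = real (a i * (b i * a i + 2))"
      by (rule arg_cong)
    then have W: "real (W i) = real (a i) * (real (b i) * real (a i) + 2) - 1"
      by (simp add: algebra_simps)
    \<comment> \<open>With \<open>a\<close> and \<open>b\<close> for \<open>a i\<close> and
      \<open>b i\<close>, both sides equal \<open>A * (b * a + 2 - 1 / a)\<close>.\<close>
    show ?thesis
      unfolding A_M[OF i] of_nat_mult sq pow base W
      using ab by (simp add: field_simps power2_eq_square)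
  qed
  have "real_of_int (frobenius_number S) = (\<Sum>i\<in>I. real (M i * W i)) - real A"
    using F by simp
  also have "\<dots> = real A * (- 1 + (\<Sum>i\<in>I. (real (fst i) ^ (2 * t * (snd i + 1)) - real (fst i) ^ t) /
      (real (fst i) ^ (t * (snd i + 1)) - 1)))"
    by (simp only: distrib_left sum_distrib_left term_eq cong: sum.cong)
  finally show ?thesis
    using F unfolding A_def I_def case_prod_beta by blast
qed

end
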